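(* Let $A\in\mathbb{R}^{n\times n}$ be a matrix with all entries positive, and let $T$ be the associated nonlinear operator $T\mathbf{z}=U A^T U A\mathbf{z}$, where $U$ is the entrywise reciprocal. For each vector $\mathbf{z}\in\mathbb{R}^n$ with all entries positive, $$T\mathbf{z}=J_T(\mathbf{z})\cdot\mathbf{z},$$ where $J_T(\mathbf{z})$ denotes the Jacobian matrix of $T$ at $\mathbf{z}$.
   Context: For a vector $\mathbf{x}\in\mathbb{R}^n$ with positive entries, $U\mathbf{x}=(1/x_1,\dots,1/x_n)^T$ is the entrywise reciprocal. Componentwise, $T$ is given by $$(T\mathbf{x})_s=\left(\sum_{m=1}^n a_{m,s}\Big(\sum_{\ell=1}^n a_{m,\ell}x_\ell\Big)^{-1}\right)^{-1},\qquad 1\le s\le n.$$ Since $A$ has positive entries, $T$ maps the open positive orthant $\{\mathbf{x}\in\mathbb{R}^n:\mathbf{x}>\mathbf{0}\}$ (inequality entrywise) into itself and is differentiable there; $J_T(\mathbf{z})$ is the $n\times n$ matrix with $(s,j)$ entry $\partial (T\mathbf{x})_s/\partial x_j$ evaluated at $\mathbf{x}=\mathbf{z}$. *)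

theory Defs
  imports "HOL-Analysis.Analysis"
begin

(* Intended for vectors with nonzero entries; otherwise 1 / 0 = 0 applies. *)
definition entrywise_recip :: "real ^ 'n \<Rightarrow> real ^ 'n" where
  "entrywise_recip x = (\<chi> i. 1 / x $ i)"

definition T_op :: "real ^ 'n ^ 'n \<Rightarrow> real ^ 'n \<Rightarrow> real ^ 'n" where
  "T_op A x = entrywise_recip (transpose A *v entrywise_recip (A *v x))"

(* The partial derivative is the one-variable derivative, at t = z $ j, of the s-th
   component as a function of the j-th coordinate t, the other coordinates being
   those of z. As with deriv itself, an entry is only meaningful where that
   derivative exists. *)
definition jacobian_matrix :: "(real ^ 'n \<Rightarrow> real ^ 'm) \<Rightarrow> real ^ 'n \<Rightarrow> real ^ 'n ^ 'm" where
  "jacobian_matrix f z =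
     (\<chi> s j. deriv (\<lambda>t. f (\<chi> k. if k = j then t else z $ k) $ s) (z $ j))"

end

theory Submission
  imports Defs
begin

text \<open>
  The operator \<open>T\<close> is positively homogeneous of degree one: each of its two entrywise
  reciprocals inverts a scalar factor, and the two inversions cancel. The identity is therefore
  Euler's theorem on homogeneous functions: differentiating \<open>T (t z) = t T z\<close> at \<open>t = 1\<close> gives
  \<open>J z = T z\<close>, where \<open>J\<close> is the Frechet derivative at \<open>z\<close>. The partial derivatives alone would
  not justify this chain rule, so total differentiability is proved first. It holds because \<open>T\<close> is a
  composition of linear maps with entrywise reciprocals taken at vectors with nonzero entries,
  positivity of \<open>A\<close> and \<open>z\<close> keeping all these entries positive. The Jacobian matrix then
  represents the Frechet derivative.
\<close>

text \<open>
  Varying one coordinate moves along a line through \<open>z\<close> whose velocity is a standard basis vector.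
  By the chain rule the columns of the Jacobian matrix are thus the values of the Frechet
  derivative on the basis.
\<close>

lemma jacobian_matrix_mult_vec:
  fixes f :: "real ^ 'n \<Rightarrow> real ^ 'm"
  assumes "(f has_derivative f') (at z)"
  shows "jacobian_matrix f z *v h = f' h"
proof -
  have entry: "jacobian_matrix f z $ s $ j = f' (axis j 1) $ s" for s j
  proof -
    let ?line = "\<lambda>t. z + (t - z $ j) *\<^sub>R axis j (1::real)"
    have line: "(\<chi> k. if k = j then t else z $ k) = ?line t" for t
      by (simp add: vec_eq_iff axis_def)
    have "(?line has_vector_derivative axis j 1) (at (z $ j))"
      unfolding has_vector_derivative_def by (auto intro!: derivative_eq_intros)
    then have "((f \<circ> ?line) has_vector_derivative f' (axis j 1)) (at (z $ j))"
      using assms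
      by (intro vector_derivative_diff_chain_within) (auto intro: has_derivative_at_withinI)
    then have "((\<lambda>t. f (?line t) $ s) has_vector_derivative f' (axis j 1) $ s) (at (z $ j))"
      using bounded_linear.has_vector_derivative[OF bounded_linear_vec_nth]
      by (fastforce simp: o_def)
    then show ?thesis
      unfolding jacobian_matrix_def
      by (simp add: line DERIV_imp_deriv has_real_derivative_iff_has_vector_derivative)
  qed
  have "jacobian_matrix f z = matrix f'"
    by (simp add: vec_eq_iff entry matrix_def)
  then show ?thesis
    using has_derivative_linear[OF assms] by (simp add: matrix_works linear_matrix_vector_mul_eq)
qed

text \<open>
  Euler's theorem on homogeneous functions in degree one: along the ray through \<open>z\<close>, the chain rule
  gives the velocity \<open>f' z\<close> at \<open>t = 1\<close>, while homogeneity makes the curve a straight line with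
  velocity \<open>f z\<close>.
\<close>

lemma derivative_of_homogeneous:
  fixes f :: "'a::real_normed_vector \<Rightarrow> 'b::real_normed_vector"
  assumes deriv: "(f has_derivative f') (at z)"
    and homogeneous: "\<And>t. t > 0 \<Longrightarrow> f (t *\<^sub>R z) = t *\<^sub>R f z"
  shows "f' z = f z"
proof (rule vector_derivative_unique_at)
  have "((\<lambda>t. t *\<^sub>R z) has_vector_derivative z) (at (1::real))"
    unfolding has_vector_derivative_def by (auto intro!: derivative_eq_intros)
  then have "((f \<circ> (\<lambda>t. t *\<^sub>R z)) has_vector_derivative f' z) (at (1::real))"
    using deriv
    by (intro vector_derivative_diff_chain_within) (auto intro: has_derivative_at_withinI)
  then show "((\<lambda>t. f (t *\<^sub>R z)) has_vector_derivative f' z) (at (1::real))"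
    by (simp add: o_def)
  have "((\<lambda>t. t *\<^sub>R f z) has_vector_derivative f z) (at (1::real))"
    unfolding has_vector_derivative_def by (auto intro!: derivative_eq_intros)
  then show "((\<lambda>t. f (t *\<^sub>R z)) has_vector_derivative f z) (at (1::real))"
    by (rule has_vector_derivative_transform_within_open[where S = "{0<..}"])
      (auto simp: homogeneous)
qed

text \<open>
  These scaling laws hold for every real \<open>c\<close> and \<open>x\<close>, because \<open>1 / 0 = 0\<close> makes inversion
  multiplicative on all reals.
\<close>

lemma entrywise_recip_scaleR: "entrywise_recip (c *\<^sub>R x) = inverse c *\<^sub>R entrywise_recip x"
  by (simp add: entrywise_recip_def vec_eq_iff divide_inverse)

lemma T_op_scaleR: "T_op A (c *\<^sub>R x) = c *\<^sub>R T_op A x"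
  by (simp add: T_op_def entrywise_recip_scaleR matrix_vector_mult_scaleR)

lemma entrywise_recip_differentiable:
  assumes "\<And>i. x $ i \<noteq> 0"
  shows "entrywise_recip differentiable (at x)"
proof -
  have "(\<lambda>y. entrywise_recip y \<bullet> b) differentiable (at x)" if b_Basis: "b \<in> Basis" for b
  proof -
    obtain i where b: "b = axis i 1"
      using b_Basis by (auto simp: Basis_vec_def)
    have "(\<lambda>y. y $ i) differentiable (at x)"
      by (intro bounded_linear_imp_differentiable bounded_linear_vec_nth)
    then have "(\<lambda>y. 1 / y $ i) differentiable (at x)"
      using assms by (intro differentiable_divide) auto
    then show ?thesis
      by (simp add: b entrywise_recip_def inner_axis)
  qed
  then show ?thesis
    by (subst differentiable_componentwise_within) blast
qed

lemma matrix_vector_mult_pos: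
  fixes A :: "real ^ 'n ^ 'm"
  assumes "\<And>i j. A $ i $ j > 0" and "\<And>j. x $ j > 0"
  shows "(A *v x) $ i > 0"
  using assms by (auto simp: matrix_vector_mult_def intro!: sum_pos)

lemma T_op_differentiable:
  fixes A :: "real ^ 'n ^ 'n"
  assumes A: "\<And>i j. A $ i $ j > 0" and x: "\<And>i. x $ i > 0"
  shows "T_op A differentiable (at x)"
proof -
  let ?u = "entrywise_recip (A *v x)"
  have Ax: "(A *v x) $ i > 0" for i
    using A x by (rule matrix_vector_mult_pos)
  then have u: "?u $ i > 0" for i
    by (simp add: entrywise_recip_def)
  have Atu: "(transpose A *v ?u) $ i > 0" for i
    using A u by (intro matrix_vector_mult_pos) (auto simp: transpose_def)
  have lin: "((*v) B) differentiable (at y)" for B :: "real ^ 'n ^ 'n" and y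
    by (intro bounded_linear_imp_differentiable matrix_vector_mul_bounded_linear)
  have recip: "entrywise_recip differentiable (at y)" if "\<And>i. y $ i > 0" for y :: "real ^ 'n"
    using that by (intro entrywise_recip_differentiable) (simp add: less_imp_neq[symmetric])
  have "entrywise_recip \<circ> (*v) A differentiable (at x)"
    by (rule differentiable_chain_at[OF lin recip[OF Ax]])
  then have "(*v) (transpose A) \<circ> (entrywise_recip \<circ> (*v) A) differentiable (at x)"
    by (rule differentiable_chain_at[OF _ lin])
  then have "entrywise_recip \<circ> ((*v) (transpose A) \<circ> (entrywise_recip \<circ> (*v) A))
      differentiable (at x)"
    by (rule differentiable_chain_at) (simp only: o_def, rule recip[OF Atu])
  then show ?thesis
    by (simp add: o_def T_op_def[abs_def])
qed

theorem theorem2p7: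
  fixes A :: "real ^ 'n ^ 'n" and z :: "real ^ 'n"
  assumes "\<And>i j. A $ i $ j > 0"
    and "\<And>i. z $ i > 0"
  shows "T_op A z = jacobian_matrix (T_op A) z *v z"
proof -
  obtain T' where T': "(T_op A has_derivative T') (at z)"
    using T_op_differentiable[OF assms] by (auto simp: differentiable_def)
  then have "T' z = T_op A z"
    by (rule derivative_of_homogeneous) (simp add: T_op_scaleR)
  then show ?thesis
    by (simp add: jacobian_matrix_mult_vec[OF T'])
qed

end
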